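(* Let $K$ and $K'$ be simplicial complexes with $K'$ edge-path connected, and let $\varphi_1,\dots,\varphi_n:K\to K'$ be arbitrary simplicial maps. Then $\mathrm{SD}(\varphi_1,\dots,\varphi_n)\le\mathrm{scat}(K)$.
   Context: Simplicial complexes are abstract simplicial complexes. Two simplicial maps $\varphi,\psi:K\to L$ are contiguous if for every simplex $\{v_0,\dots,v_k\}$ of $K$ the set $\{\varphi(v_0),\dots,\varphi(v_k),\psi(v_0),\dots,\psi(v_k)\}$ is a simplex of $L$. They are in the same contiguity class, written $\varphi\sim\psi$, if there is a finite sequence of simplicial maps $K\to L$ from $\varphi$ to $\psi$ in which consecutive maps are contiguous. A simplicial complex is edge-path connected if any two vertices can be joined by a finite sequence of vertices in which consecutive vertices span an edge. For simplicial maps $\varphi_1,\dots,\varphi_n:K\to K'$, the $n$-th contiguity distance $\mathrm{SD}(\varphi_1,\dots,\varphi_n)$ is the least integer $k\ge 0$ such that $K$ is covered by subcomplexes $K_0,\dots,K_k$ with $\varphi_1|_{K_j},\dots,\varphi_n|_{K_j}:K_j\to K'$ all in the same contiguity class for each $j=0,\dots,k$; it is $\infty$ if there is no such covering. A subcomplex $\Omega\subset K$ is categorical if the inclusion $\Omega\hookrightarrow K$ and a constant map $c_{v}:\Omega\to K$ at some vertex $v$ of $K$ are in the same contiguity class. The simplicial Lusternik-Schnirelmann category $\mathrm{scat}(K)$ is the least integer $k\ge 0$ such that $K$ is covered by categorical subcomplexes $\Omega_0,\dots,\Omega_k$ ($\infty$ if there is no such covering). *)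

theory Defs
  imports "HOL-Library.Extended_Nat"
begin

text \<open>
  An abstract simplicial complex is the set of its (nonempty, finite) simplices; the empty set
  is not counted as a simplex. Complexes may be infinite, and the complex without simplices
  is allowed.
\<close>

definition simplicial_complex :: "'a set set \<Rightarrow> bool" where
  "simplicial_complex K \<longleftrightarrow>
     (\<forall>s\<in>K. finite s \<and> s \<noteq> {}) \<and> (\<forall>s\<in>K. \<forall>t. t \<subseteq> s \<and> t \<noteq> {} \<longrightarrow> t \<in> K)"

definition vertices :: "'a set set \<Rightarrow> 'a set" where
  "vertices K = \<Union>K"

definition subcomplex :: "'a set set \<Rightarrow> 'a set set \<Rightarrow> bool" where
  "subcomplex A K \<longleftrightarrow> simplicial_complex A \<and> A \<subseteq> K"

text \<open>
  A simplicial map is represented by a total function of which only the values on the vertices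
  of the domain matter. Its restriction to a subcomplex \<open>A\<close> is the same function regarded as a
  map with domain \<open>A\<close>; the inclusion of a subcomplex is the identity function. Two functions
  representing the same simplicial map are contiguous, so the relations below do not depend on
  the representatives.
\<close>

definition simplicial_map :: "'a set set \<Rightarrow> 'b set set \<Rightarrow> ('a \<Rightarrow> 'b) \<Rightarrow> bool" where
  "simplicial_map K L f \<longleftrightarrow> (\<forall>s\<in>K. f ` s \<in> L)"

definition contiguous :: "'a set set \<Rightarrow> 'b set set \<Rightarrow> ('a \<Rightarrow> 'b) \<Rightarrow> ('a \<Rightarrow> 'b) \<Rightarrow> bool" where
  "contiguous K L f g \<longleftrightarrow>
     simplicial_map K L f \<and> simplicial_map K L g \<and> (\<forall>s\<in>K. f ` s \<union> g ` s \<in> L)"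

definition same_contiguity_class ::
    "'a set set \<Rightarrow> 'b set set \<Rightarrow> ('a \<Rightarrow> 'b) \<Rightarrow> ('a \<Rightarrow> 'b) \<Rightarrow> bool" where
  "same_contiguity_class K L f g \<longleftrightarrow>
     simplicial_map K L f \<and> simplicial_map K L g \<and> (contiguous K L)\<^sup>*\<^sup>* f g"

definition edge_path_connected :: "'a set set \<Rightarrow> bool" where
  "edge_path_connected K \<longleftrightarrow>
     (\<forall>u\<in>vertices K. \<forall>v\<in>vertices K. (\<lambda>x y. x \<noteq> y \<and> {x, y} \<in> K)\<^sup>*\<^sup>* u v)"

text \<open>In \<^typ>\<open>enat\<close> the infimum of the empty set is \<open>\<infinity>\<close>, and any other infimum is a minimum.\<close>

definition SD :: "'a set set \<Rightarrow> 'b set set \<Rightarrow> nat \<Rightarrow> (nat \<Rightarrow> 'a \<Rightarrow> 'b) \<Rightarrow> enat" where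
  "SD K L n \<phi> = Inf {enat k | k. \<exists>C :: nat \<Rightarrow> 'a set set.
     (\<forall>j\<le>k. subcomplex (C j) K) \<and> (\<Union>j\<le>k. C j) = K \<and>
     (\<forall>j\<le>k. \<forall>p\<in>{1..n}. \<forall>q\<in>{1..n}. same_contiguity_class (C j) L (\<phi> p) (\<phi> q))}"

definition categorical :: "'a set set \<Rightarrow> 'a set set \<Rightarrow> bool" where
  "categorical K A \<longleftrightarrow> subcomplex A K \<and>
     (\<exists>v\<in>vertices K. same_contiguity_class A K (\<lambda>x. x) (\<lambda>x. v))"

definition scat :: "'a set set \<Rightarrow> enat" where
  "scat K = Inf {enat k | k. \<exists>C :: nat \<Rightarrow> 'a set set.
     (\<forall>j\<le>k. categorical K (C j)) \<and> (\<Union>j\<le>k. C j) = K}"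

end

theory Submission imports Defs begin

text \<open>
  Any covering of \<open>K\<close> by categorical subcomplexes is already admissible for the contiguity
  distance, so the infimum defining \<^term>\<open>SD K K' n \<phi>\<close> ranges over a larger set than the
  one defining \<^term>\<open>scat K\<close>. Indeed, let \<open>A\<close> be categorical, contracting to the vertex \<open>v\<close>.
  Composing the chain of contiguities from the inclusion to the constant map with \<open>\<phi>\<^sub>p\<close> shows
  that \<open>\<phi>\<^sub>p\<close> restricted to \<open>A\<close> lies in the class of the constant map at \<open>\<phi>\<^sub>p v\<close>
  (\<open>same_contiguity_class_compose\<close>). Constant maps at the two ends of an edge are
  contiguous, so an edge path in \<open>K'\<close> from \<open>\<phi>\<^sub>p v\<close> to \<open>\<phi>\<^sub>q v\<close> puts all these constant maps in
  one class (\<open>same_contiguity_class_const\<close>), and with them the restrictions of all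
  the \<open>\<phi>\<^sub>p\<close>.
\<close>

lemma same_contiguity_class_sym:
  assumes "same_contiguity_class K L f g"
  shows "same_contiguity_class K L g f"
proof -
  have "symp (contiguous K L)"
    by (simp add: symp_def contiguous_def Un_commute)
  then have "symp (contiguous K L)\<^sup>*\<^sup>*"
    by (rule symp_rtranclp)
  with assms show ?thesis
    using sympD[of "(contiguous K L)\<^sup>*\<^sup>*" f g] by (simp add: same_contiguity_class_def)
qed

lemma same_contiguity_class_trans:
  assumes "same_contiguity_class K L f g" and "same_contiguity_class K L g h"
  shows "same_contiguity_class K L f h"
  using assms rtranclp_trans[of "contiguous K L" f g h] by (simp add: same_contiguity_class_def)

lemma simplicial_map_compose:
  assumes "simplicial_map A K f" and "simplicial_map K L h"
  shows "simplicial_map A L (\<lambda>x. h (f x))"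
proof -
  have "h ` (f ` s) \<in> L" if "s \<in> A" for s
    using assms that by (simp add: simplicial_map_def)
  then show ?thesis
    by (simp add: simplicial_map_def image_image)
qed

lemma contiguous_compose:
  assumes "contiguous A K f g" and h: "simplicial_map K L h"
  shows "contiguous A L (\<lambda>x. h (f x)) (\<lambda>x. h (g x))"
proof -
  have "h ` (f ` s \<union> g ` s) \<in> L" if "s \<in> A" for s
    using assms that by (simp add: contiguous_def simplicial_map_def)
  moreover have "simplicial_map A L (\<lambda>x. h (f x))" "simplicial_map A L (\<lambda>x. h (g x))"
    using assms simplicial_map_compose[of A K _ L h] by (auto simp: contiguous_def)
  ultimately show ?thesis
    by (simp add: contiguous_def image_Un image_image)
qed

lemma same_contiguity_class_compose:
  assumes "same_contiguity_class A K f g" and h: "simplicial_map K L h"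
  shows "same_contiguity_class A L (\<lambda>x. h (f x)) (\<lambda>x. h (g x))"
proof -
  from assms have "(contiguous A K)\<^sup>*\<^sup>* f g"
    by (simp add: same_contiguity_class_def)
  then have "(contiguous A L)\<^sup>*\<^sup>* (\<lambda>x. h (f x)) (\<lambda>x. h (g x))"
  proof induction
    case (step g g')
    from step.IH contiguous_compose[OF step.hyps(2) h] show ?case
      by (simp add: rtranclp.rtrancl_into_rtrancl)
  qed simp
  with assms simplicial_map_compose[of A K _ L h] show ?thesis
    by (simp add: same_contiguity_class_def)
qed

lemma vertex_singleton:
  assumes "simplicial_complex L" and "u \<in> vertices L"
  shows "{u} \<in> L"
proof -
  from assms(2) obtain s where "s \<in> L" "{u} \<subseteq> s"
    by (auto simp: vertices_def)
  with assms(1) show ?thesis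
    unfolding simplicial_complex_def by (metis insert_not_empty)
qed

lemma simplicial_map_vertex:
  assumes "simplicial_map K L h" and "v \<in> vertices K"
  shows "h v \<in> vertices L"
proof -
  from assms(2) obtain s where "s \<in> K" "v \<in> s"
    by (auto simp: vertices_def)
  with assms(1) have "h ` s \<in> L" "h v \<in> h ` s"
    by (simp_all add: simplicial_map_def)
  then show ?thesis
    unfolding vertices_def by (rule UnionI)
qed

text \<open>
  Simplices of \<open>A\<close> are nonempty, so constant maps at \<open>x\<close> and \<open>y\<close> together send each of them
  onto \<open>{x, y}\<close>: contiguity of the two maps is exactly what an edge from \<open>x\<close> to \<open>y\<close> provides.
\<close>

lemma contiguous_const:
  assumes A: "simplicial_complex A" and L: "simplicial_complex L" and edge: "{x, y} \<in> L"
  shows "contiguous A L (\<lambda>_. x) (\<lambda>_. y)"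
proof -
  have im: "(\<lambda>_. z) ` s = {z}" if "s \<in> A" for s and z :: 'b
    using A that by (auto simp: simplicial_complex_def)
  have "{x} \<in> L" "{y} \<in> L"
    using L edge by (auto intro!: vertex_singleton bexI[OF _ edge] simp: vertices_def)
  with edge show ?thesis
    by (simp add: contiguous_def simplicial_map_def im insert_commute)
qed

lemma same_contiguity_class_const:
  assumes A: "simplicial_complex A" and L: "simplicial_complex L"
    and conn: "edge_path_connected L"
    and u: "u \<in> vertices L" and w: "w \<in> vertices L"
  shows "same_contiguity_class A L (\<lambda>_. u) (\<lambda>_. w)"
proof -
  have const: "simplicial_map A L (\<lambda>_. z)" if "z \<in> vertices L" for z
    using contiguous_const[OF A L, of z z] vertex_singleton[OF L that]
    by (simp add: contiguous_def)
  have "(\<lambda>x y. x \<noteq> y \<and> {x, y} \<in> L)\<^sup>*\<^sup>* u w"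
    using conn u w by (simp add: edge_path_connected_def)
  then have "(contiguous A L)\<^sup>*\<^sup>* (\<lambda>_. u) (\<lambda>_. w)"
  proof induction
    case (step y z)
    then have "contiguous A L (\<lambda>_. y) (\<lambda>_. z)"
      by (simp add: contiguous_const[OF A L])
    with step.IH show ?case
      by (simp add: rtranclp.rtrancl_into_rtrancl)
  qed simp
  with const u w show ?thesis
    by (simp add: same_contiguity_class_def)
qed

text \<open>
  Both maps are pushed along the contraction of \<open>A\<close> to a constant map, and the two constants
  are joined by an edge path in the target.
\<close>

lemma same_contiguity_class_on_categorical:
  assumes cat: "categorical K A"
    and L: "simplicial_complex L" and conn: "edge_path_connected L"
    and f: "simplicial_map K L f" and g: "simplicial_map K L g"
  shows "same_contiguity_class A L f g"
proof -
  from cat obtain v where A: "simplicial_complex A" and v: "v \<in> vertices K"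
    and contr: "same_contiguity_class A K (\<lambda>x. x) (\<lambda>_. v)"
    unfolding categorical_def subcomplex_def by blast
  have "same_contiguity_class A L f (\<lambda>_. f v)"
    using same_contiguity_class_compose[OF contr f] by simp
  moreover have "same_contiguity_class A L (\<lambda>_. f v) (\<lambda>_. g v)"
    by (intro same_contiguity_class_const A L conn
        simplicial_map_vertex[OF f v] simplicial_map_vertex[OF g v])
  moreover have "same_contiguity_class A L (\<lambda>_. g v) g"
    using same_contiguity_class_sym[OF same_contiguity_class_compose[OF contr g]] by simp
  ultimately show ?thesis
    by (rule same_contiguity_class_trans[OF same_contiguity_class_trans])
qed

theorem corollary3p5:
  fixes K :: "'a set set" and K' :: "'b set set"
    and n :: nat and \<phi> :: "nat \<Rightarrow> 'a \<Rightarrow> 'b"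
  assumes "simplicial_complex K" and "simplicial_complex K'"
    and "edge_path_connected K'"
    and "n \<ge> 1"
    and "\<And>i. i \<in> {1..n} \<Longrightarrow> simplicial_map K K' (\<phi> i)"
  shows "SD K K' n \<phi> \<le> scat K"
proof -
  have sub: "subcomplex A K" if "categorical K A" for A
    using that by (simp add: categorical_def)
  have same: "same_contiguity_class A K' (\<phi> p) (\<phi> q)"
    if "categorical K A" "p \<in> {1..n}" "q \<in> {1..n}" for A p q
    by (rule same_contiguity_class_on_categorical[OF that(1) assms(2,3)])
      (fact assms(5)[OF that(2)] assms(5)[OF that(3)])+
  have cover: "(\<forall>j\<le>k. subcomplex (C j) K) \<and> (\<Union>j\<le>k. C j) = K \<and>
      (\<forall>j\<le>k. \<forall>p\<in>{1..n}. \<forall>q\<in>{1..n}. same_contiguity_class (C j) K' (\<phi> p) (\<phi> q))"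
    if "(\<forall>j\<le>k. categorical K (C j)) \<and> (\<Union>j\<le>k. C j) = K" for k and C :: "nat \<Rightarrow> 'a set set"
    using that by (intro conjI allI impI ballI) (simp_all add: sub same)
  show ?thesis
    unfolding SD_def scat_def
    by (rule Inf_superset_mono, rule Collect_mono, rule ex_mono, rule conj_mono[OF imp_refl],
        rule ex_mono, rule impI, rule cover)
qed

end
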